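(* Let $p,q\ge 1$ and $n\ge 2$ be integers, $N=\{1,\dots,n\}$, and let $\mathcal{A}=(a_{i_1\cdots i_pj_1\cdots j_q})\in\mathbb{R}^{[p,q;n,n]}_+$ be a nonnegative rectangular tensor with largest singular value $\lambda_0$. Let $S$ be a nonempty proper subset of $N$ and $\bar S=N\setminus S$. Then $$\Theta^S(\mathcal{A})\le\lambda_0\le\Phi^S(\mathcal{A}),$$ where $$\Theta^S(\mathcal{A})=\min\{\hat\Theta^S(\mathcal{A}),\hat\Theta^{\bar S}(\mathcal{A}),\tilde\Theta^S(\mathcal{A}),\tilde\Theta^{\bar S}(\mathcal{A})\},\qquad \Phi^S(\mathcal{A})=\max\{\hat\Phi^S(\mathcal{A}),\hat\Phi^{\bar S}(\mathcal{A}),\tilde\Phi^S(\mathcal{A}),\tilde\Phi^{\bar S}(\mathcal{A})\},$$ and, for $T\in\{S,\bar S\}$ with complement $\bar T=N\setminus T$, $$\hat\Phi^T(\mathcal{A})=\max_{i\in T,\,j\in\bar T}\tfrac12\left\{r_j^{\overline{\Delta^T}}(\mathcal{A})+\left[(r_j^{\overline{\Delta^T}}(\mathcal{A}))^2+4r_j^{\Delta^T}(\mathcal{A})\max\{R_i(\mathcal{A}),C_i(\mathcal{A})\}\right]^{1/2}\right\},$$ $$\tilde\Phi^T(\mathcal{A})=\max_{i\in T,\,j\in\bar T}\tfrac12\left\{c_j^{\overline{\Omega^T}}(\mathcal{A})+\left[(c_j^{\overline{\Omega^T}}(\mathcal{A}))^2+4c_j^{\Omega^T}(\mathcal{A})\max\{R_i(\mathcal{A}),C_i(\mathcal{A})\}\right]^{1/2}\right\},$$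 $$\hat\Theta^T(\mathcal{A})=\min_{i\in T,\,j\in\bar T}\tfrac12\left\{r_j^{\overline{\Delta^T}}(\mathcal{A})+\left[(r_j^{\overline{\Delta^T}}(\mathcal{A}))^2+4r_j^{\Delta^T}(\mathcal{A})\min\{R_i(\mathcal{A}),C_i(\mathcal{A})\}\right]^{1/2}\right\},$$ $$\tilde\Theta^T(\mathcal{A})=\min_{i\in T,\,j\in\bar T}\tfrac12\left\{c_j^{\overline{\Omega^T}}(\mathcal{A})+\left[(c_j^{\overline{\Omega^T}}(\mathcal{A}))^2+4c_j^{\Omega^T}(\mathcal{A})\min\{R_i(\mathcal{A}),C_i(\mathcal{A})\}\right]^{1/2}\right\}.$$
   Context: $\mathbb{R}^{[p,q;n,n]}_+$ is the set of arrays $\mathcal{A}=(a_{i_1\cdots i_pj_1\cdots j_q})$ of nonnegative real numbers with all indices in $N=\{1,\dots,n\}$. Put $l=p+q$. Singular values: $\lambda\in\mathbb{C}$ is a singular value of $\mathcal{A}$ if there are $x\in\mathbb{C}^n\setminus\{0\}$ and $y\in\mathbb{C}^n\setminus\{0\}$ with $\mathcal{A}x^{p-1}y^q=\lambda x^{[l-1]}$ and $\mathcal{A}x^py^{q-1}=\lambda y^{[l-1]}$, where $(x^{[l-1]})_i=x_i^{l-1}$, $(y^{[l-1]})_j=y_j^{l-1}$, $$(\mathcal{A}x^{p-1}y^q)_i=\sum_{i_2,\dots,i_p=1}^n\sum_{j_1,\dots,j_q=1}^n a_{ii_2\cdots i_pj_1\cdots j_q}x_{i_2}\cdots x_{i_p}y_{j_1}\cdots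 y_{j_q},$$ $$(\mathcal{A}x^{p}y^{q-1})_j=\sum_{i_1,\dots,i_p=1}^n\sum_{j_2,\dots,j_q=1}^n a_{i_1\cdots i_pjj_2\cdots j_q}x_{i_1}\cdots x_{i_p}y_{j_2}\cdots y_{j_q}.$$ The largest singular value is $\lambda_0=\max\{|\lambda|:\lambda\text{ is a singular value of }\mathcal{A}\}$. Row/column sums: $R_i(\mathcal{A})=\sum_{i_2,\dots,i_p,j_1,\dots,j_q\in N}|a_{ii_2\cdots i_pj_1\cdots j_q}|$ and $C_j(\mathcal{A})=\sum_{i_1,\dots,i_p,j_2,\dots,j_q\in N}|a_{i_1\cdots i_pjj_2\cdots j_q}|$. For $T\subseteq N$ let $\Delta^T=\{(i_2,\dots,i_p,j_1,\dots,j_q): \text{all entries in }T\}$, $\Omega^T=\{(i_1,\dots,i_p,j_2,\dots,j_q):\text{all entries in }T\}$, $\overline{\Delta^T}=\Delta^N\setminus\Delta^T$, $\overline{\Omega^T}=\Omega^N\setminus\Omega^T$. For $i,j\in N$, with $\Delta'\in\{\Delta^T,\overline{\Delta^T}\}$ and $\Omega'\in\{\Omega^T,\overline{\Omega^T}\}$, $$r_i^{\Delta'}(\mathcal{A})=\sum_{(i_2,\dots,i_p,j_1,\dots,j_q)\in\Delta'}|a_{ii_2\cdots i_pj_1\cdots j_q}|,\qquad c_j^{\Omega'}(\mathcal{A})=\sum_{(i_1,\dots,i_p,j_2,\dots,j_q)\in\Omega'}|a_{i_1\cdots i_pjj_2\cdots j_q}|.$$ *)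

theory Defs
  imports "HOL-Analysis.Analysis"
begin

text \<open>
  The index set \<open>N = {1, \<dots>, n}\<close> is the universe of a finite type \<open>'n\<close>, so \<open>n = CARD('n)\<close>
  and complements are taken in \<open>UNIV\<close>. An array \<open>(a\<^bsub>i1\<dots>ip j1\<dots>jq\<^esub>)\<close> is a function of the two
  index lists \<open>[i1, \<dots>, ip]\<close> and \<open>[j1, \<dots>, jq]\<close>; its values at lists of other lengths are
  never used.
\<close>

type_synonym 'n rect_tensor = "'n list \<Rightarrow> 'n list \<Rightarrow> real"

definition nonneg_tensor :: "nat \<Rightarrow> nat \<Rightarrow> 'n::finite rect_tensor \<Rightarrow> bool" where
  "nonneg_tensor p q a \<longleftrightarrow>
     (\<forall>is js. length is = p \<longrightarrow> length js = q \<longrightarrow> 0 \<le> a is js)"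

text \<open>
  \<open>Delta p q T\<close> consists of the tuples \<open>(i2, \<dots>, ip, j1, \<dots>, jq)\<close> and \<open>Omega p q T\<close> of the
  tuples \<open>(i1, \<dots>, ip, j2, \<dots>, jq)\<close> with all entries in \<open>T\<close>, both split into the \<open>i\<close>-part and
  the \<open>j\<close>-part. They are meant for \<open>p, q \<ge> 1\<close>.
\<close>

definition Delta :: "nat \<Rightarrow> nat \<Rightarrow> 'n::finite set \<Rightarrow> ('n list \<times> 'n list) set" where
  "Delta p q T =
     {(is, js). length is = p - 1 \<and> length js = q \<and> set is \<subseteq> T \<and> set js \<subseteq> T}"

definition Omega :: "nat \<Rightarrow> nat \<Rightarrow> 'n::finite set \<Rightarrow> ('n list \<times> 'n list) set" where
  "Omega p q T =
     {(is, js). length is = p \<and> length js = q - 1 \<and> set is \<subseteq> T \<and> set js \<subseteq> T}"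

definition Delta_compl :: "nat \<Rightarrow> nat \<Rightarrow> 'n::finite set \<Rightarrow> ('n list \<times> 'n list) set" where
  "Delta_compl p q T = Delta p q UNIV - Delta p q T"

definition Omega_compl :: "nat \<Rightarrow> nat \<Rightarrow> 'n::finite set \<Rightarrow> ('n list \<times> 'n list) set" where
  "Omega_compl p q T = Omega p q UNIV - Omega p q T"

definition row_part :: "'n::finite rect_tensor \<Rightarrow> ('n list \<times> 'n list) set \<Rightarrow> 'n \<Rightarrow> real" where
  "row_part a D i = (\<Sum>(is, js)\<in>D. \<bar>a (i # is) js\<bar>)"

definition col_part :: "'n::finite rect_tensor \<Rightarrow> ('n list \<times> 'n list) set \<Rightarrow> 'n \<Rightarrow> real" where
  "col_part a W j = (\<Sum>(is, js)\<in>W. \<bar>a is (j # js)\<bar>)"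

definition row_sum :: "nat \<Rightarrow> nat \<Rightarrow> 'n::finite rect_tensor \<Rightarrow> 'n \<Rightarrow> real" where
  "row_sum p q a i = row_part a (Delta p q UNIV) i"

definition col_sum :: "nat \<Rightarrow> nat \<Rightarrow> 'n::finite rect_tensor \<Rightarrow> 'n \<Rightarrow> real" where
  "col_sum p q a j = col_part a (Omega p q UNIV) j"

definition monom_val :: "complex ^ 'n::finite \<Rightarrow> 'n list \<Rightarrow> complex" where
  "monom_val x is = (\<Prod>k\<leftarrow>is. x $ k)"

text \<open>The vectors \<open>A x\<^bsup>p-1\<^esup> y\<^bsup>q\<^esup>\<close> and \<open>A x\<^bsup>p\<^esup> y\<^bsup>q-1\<^esup>\<close>.\<close>

definition tensor_left ::
    "nat \<Rightarrow> nat \<Rightarrow> 'n::finite rect_tensor \<Rightarrow> complex ^ 'n \<Rightarrow> complex ^ 'n \<Rightarrow> complex ^ 'n" where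
  "tensor_left p q a x y =
     (\<chi> i. \<Sum>(is, js)\<in>Delta p q UNIV. of_real (a (i # is) js) * monom_val x is * monom_val y js)"

definition tensor_right ::
    "nat \<Rightarrow> nat \<Rightarrow> 'n::finite rect_tensor \<Rightarrow> complex ^ 'n \<Rightarrow> complex ^ 'n \<Rightarrow> complex ^ 'n" where
  "tensor_right p q a x y =
     (\<chi> j. \<Sum>(is, js)\<in>Omega p q UNIV. of_real (a is (j # js)) * monom_val x is * monom_val y js)"

definition vec_power :: "complex ^ 'n::finite \<Rightarrow> nat \<Rightarrow> complex ^ 'n" where
  "vec_power x m = (\<chi> i. (x $ i) ^ m)"

definition singular_value :: "nat \<Rightarrow> nat \<Rightarrow> 'n::finite rect_tensor \<Rightarrow> complex \<Rightarrow> bool" where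
  "singular_value p q a \<mu> \<longleftrightarrow>
     (\<exists>x y. x \<noteq> 0 \<and> y \<noteq> 0 \<and>
        tensor_left p q a x y = \<mu> *s vec_power x (p + q - 1) \<and>
        tensor_right p q a x y = \<mu> *s vec_power y (p + q - 1))"

text \<open>
  The maximum of the moduli is written with \<open>GREATEST\<close> rather than \<open>Max\<close>, since the latter is
  only specified for finite sets.
\<close>

definition largest_singular_value :: "nat \<Rightarrow> nat \<Rightarrow> 'n::finite rect_tensor \<Rightarrow> real" where
  "largest_singular_value p q a = (GREATEST r. \<exists>\<mu>. singular_value p q a \<mu> \<and> r = cmod \<mu>)"

definition root_expr :: "real \<Rightarrow> real \<Rightarrow> real \<Rightarrow> real" where
  "root_expr u v m = 1/2 * (u + sqrt (u\<^sup>2 + 4 * v * m))"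

definition Phi_hat :: "nat \<Rightarrow> nat \<Rightarrow> 'n::finite rect_tensor \<Rightarrow> 'n set \<Rightarrow> real" where
  "Phi_hat p q a T = Max ((\<lambda>(i, j).
     root_expr (row_part a (Delta_compl p q T) j) (row_part a (Delta p q T) j)
       (max (row_sum p q a i) (col_sum p q a i))) ` (T \<times> - T))"

definition Phi_tilde :: "nat \<Rightarrow> nat \<Rightarrow> 'n::finite rect_tensor \<Rightarrow> 'n set \<Rightarrow> real" where
  "Phi_tilde p q a T = Max ((\<lambda>(i, j).
     root_expr (col_part a (Omega_compl p q T) j) (col_part a (Omega p q T) j)
       (max (row_sum p q a i) (col_sum p q a i))) ` (T \<times> - T))"

definition Theta_hat :: "nat \<Rightarrow> nat \<Rightarrow> 'n::finite rect_tensor \<Rightarrow> 'n set \<Rightarrow> real" where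
  "Theta_hat p q a T = Min ((\<lambda>(i, j).
     root_expr (row_part a (Delta_compl p q T) j) (row_part a (Delta p q T) j)
       (min (row_sum p q a i) (col_sum p q a i))) ` (T \<times> - T))"

definition Theta_tilde :: "nat \<Rightarrow> nat \<Rightarrow> 'n::finite rect_tensor \<Rightarrow> 'n set \<Rightarrow> real" where
  "Theta_tilde p q a T = Min ((\<lambda>(i, j).
     root_expr (col_part a (Omega_compl p q T) j) (col_part a (Omega p q T) j)
       (min (row_sum p q a i) (col_sum p q a i))) ` (T \<times> - T))"

definition Theta :: "nat \<Rightarrow> nat \<Rightarrow> 'n::finite rect_tensor \<Rightarrow> 'n set \<Rightarrow> real" where
  "Theta p q a S =
     Min {Theta_hat p q a S, Theta_hat p q a (- S), Theta_tilde p q a S, Theta_tilde p q a (- S)}"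

definition Phi :: "nat \<Rightarrow> nat \<Rightarrow> 'n::finite rect_tensor \<Rightarrow> 'n set \<Rightarrow> real" where
  "Phi p q a S =
     Max {Phi_hat p q a S, Phi_hat p q a (- S), Phi_tilde p q a S, Phi_tilde p q a (- S)}"

end

theory Submission
  imports Defs
begin

text \<open>
  The pair \<open>(x, y)\<close> is treated as one vector \<open>z\<close> indexed by \<open>'n + 'n\<close>. The two systems in the
  definition of a singular value then become one eigenvalue equation \<open>A z m = \<lambda> * z m ^ d\<close> with
  \<open>d = p + q - 1\<close>, where \<open>A\<close> is monotone on nonnegative vectors and homogeneous of degree \<open>d\<close>,
  so that the ideas of Perron and Frobenius apply.

  The bounds come from two coordinates of \<open>z\<close>. Let \<open>z k\<close> be the largest coordinate, \<open>g\<close> the index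
  underlying \<open>k\<close>, \<open>T\<close> that one of \<open>S\<close>, \<open>- S\<close> which does not contain \<open>g\<close>, and \<open>z h\<close> the
  largest coordinate over \<open>T\<close>. In equation \<open>k\<close> the monomials with all indices in \<open>T\<close> are at most
  \<open>z h ^ d\<close> and the others at most \<open>z k ^ d\<close>; in equation \<open>h\<close> all are at most \<open>z k ^ d\<close>.
  Eliminating the ratio of \<open>z h ^ d\<close> and \<open>z k ^ d\<close> leaves a quadratic inequality for \<open>\<lambda>\<close> whose
  larger root is \<open>root_expr\<close>; this is the upper bound (\<open>subsolution_le_Phi\<close>). Taking smallest
  coordinates instead gives the lower bound (\<open>Theta_le_supersolution\<close>). The elimination then divides
  by the smallest coordinate, so it needs \<open>z\<close> to be strictly positive, but only
  \<open>A z m \<le> c * z m ^ d\<close>.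

  A singular pair of \<open>a\<close> need not be positive, so the lower bound is proved for approximations.
  Brouwer's theorem gives positive eigenvectors of \<open>A\<close> plus a small positive term
  (\<open>perturbed_eigenvector\<close>). Their eigenvalues \<open>c\<close> dominate both \<open>Theta\<close> and, by the argument of
  Collatz and Wielandt (\<open>subsolution_le_supersolution\<close>), the modulus of every singular value. A limit
  of these eigenvectors is a singular pair (\<open>perron_singular_pair\<close>), so the limit of the \<open>c\<close> is the
  largest singular value and inherits both inequalities.

  The delicate point is that neither \<open>x\<close> nor \<open>y\<close> may vanish in the limit. Euler's identity
  \<open>\<Sum>i. x\<^sub>i * (A z)\<^sub>i = \<Sum>j. y\<^sub>j * (A z)\<^sub>j\<close> (\<open>euler_identity\<close>) makes the power sums of order \<open>p + q\<close>
  of \<open>x\<close> and \<open>y\<close> equal, and the perturbation is chosen to respect this identity.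
\<close>

section \<open>Rectangular tensors as maps on pairs of vectors\<close>

definition slots :: "nat \<Rightarrow> nat \<Rightarrow> 'n::finite set \<Rightarrow> 'n + 'n \<Rightarrow> ('n list \<times> 'n list) set" where
  "slots p q T k = (case k of Inl _ \<Rightarrow> Delta p q T | Inr _ \<Rightarrow> Omega p q T)"

fun entry :: "'n::finite rect_tensor \<Rightarrow> 'n + 'n \<Rightarrow> 'n list \<times> 'n list \<Rightarrow> real" where
  "entry a (Inl i) (is, js) = a (i # is) js"
| "entry a (Inr j) (is, js) = a is (j # js)"

text \<open>
  With the two index lists joined, a monomial in \<open>x\<close> and \<open>y\<close> is a single product of coordinates of
  \<open>z\<close>, always with \<open>d\<close> factors.
\<close>

definition word :: "'n list \<times> 'n list \<Rightarrow> ('n + 'n) list" where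
  "word t = map Inl (fst t) @ map Inr (snd t)"

definition tensor_map :: "nat \<Rightarrow> nat \<Rightarrow> 'n::finite rect_tensor \<Rightarrow> ('n + 'n \<Rightarrow> real) \<Rightarrow> 'n + 'n \<Rightarrow> real" where
  "tensor_map p q a z k = (\<Sum>t\<in>slots p q UNIV k. entry a k t * (\<Prod>m\<leftarrow>word t. z m))"

definition part :: "nat \<Rightarrow> nat \<Rightarrow> 'n::finite rect_tensor \<Rightarrow> 'n set \<Rightarrow> 'n + 'n \<Rightarrow> real" where
  "part p q a T k = (\<Sum>t\<in>slots p q T k. entry a k t)"

definition copart :: "nat \<Rightarrow> nat \<Rightarrow> 'n::finite rect_tensor \<Rightarrow> 'n set \<Rightarrow> 'n + 'n \<Rightarrow> real" where
  "copart p q a T k = (\<Sum>t\<in>slots p q UNIV k - slots p q T k. entry a k t)"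

text \<open>
  The perturbing term: an \<open>x\<close>-equation receives the total mass of \<open>y\<close> and conversely. Paired with
  \<open>x\<close> and with \<open>y\<close> it gives the same product of the two masses, as Euler's identity demands, and on
  the simplex the two masses cannot vanish together.
\<close>

definition opposite_mass :: "('n::finite + 'n \<Rightarrow> real) \<Rightarrow> 'n + 'n \<Rightarrow> real" where
  "opposite_mass z k =
     (case k of Inl _ \<Rightarrow> \<Sum>j\<in>UNIV. z (Inr j) | Inr _ \<Rightarrow> \<Sum>i\<in>UNIV. z (Inl i))"

definition simplex_on :: "(real ^ 'm::finite) set" where
  "simplex_on = {z. (\<forall>i. 0 \<le> z $ i) \<and> (\<Sum>i\<in>UNIV. z $ i) = 1}"

lemma prod_list_mono_on:
  fixes f g :: "'a \<Rightarrow> real"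
  assumes "\<And>m. m \<in> set ws \<Longrightarrow> 0 \<le> f m \<and> f m \<le> g m"
  shows "0 \<le> (\<Prod>m\<leftarrow>ws. f m) \<and> (\<Prod>m\<leftarrow>ws. f m) \<le> (\<Prod>m\<leftarrow>ws. g m)"
  using assms by (induction ws) (auto intro!: mult_mono intro: order_trans mult_nonneg_nonneg)

lemma finite_maximiser:
  fixes f :: "'a \<Rightarrow> real"
  assumes "finite X" "X \<noteq> {}"
  obtains k where "k \<in> X" "\<And>m. m \<in> X \<Longrightarrow> f m \<le> f k"
  using ex_is_arg_min_if_finite[OF assms, of "\<lambda>m. - f m"] by (auto simp: is_arg_min_linorder)

lemma prod_list_const: "(\<Prod>m\<leftarrow>ws. c) = (c::'a::comm_monoid_mult) ^ length ws"
  by (induction ws) auto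

lemma tendsto_prod_list_map:
  fixes f :: "'b \<Rightarrow> 'a \<Rightarrow> real"
  assumes "\<And>m. ((\<lambda>x. f x m) \<longlongrightarrow> g m) F"
  shows "((\<lambda>x. \<Prod>m\<leftarrow>ws. f x m) \<longlongrightarrow> (\<Prod>m\<leftarrow>ws. g m)) F"
  by (induction ws) (auto intro!: tendsto_mult assms)

lemma sum_sum_type:
  fixes f :: "'a::finite + 'b::finite \<Rightarrow> real"
  shows "(\<Sum>k\<in>UNIV. f k) = (\<Sum>i\<in>UNIV. f (Inl i)) + (\<Sum>j\<in>UNIV. f (Inr j))"
  using sum.Plus[of "UNIV :: 'a set" "UNIV :: 'b set" f] by (simp add: UNIV_Plus_UNIV o_def)

section \<open>Eigenvectors of positive maps on a simplex\<close>

lemma compact_simplex_on: "compact (simplex_on :: (real ^ 'm::finite) set)"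
proof -
  have "simplex_on \<subseteq> cbox (0 :: real ^ 'm) (\<chi> i. 1)"
  proof
    fix z :: "real ^ 'm" assume z: "z \<in> simplex_on"
    have "z $ i \<le> (\<Sum>i\<in>UNIV. z $ i)" for i
      using z by (intro member_le_sum) (auto simp: simplex_on_def)
    then show "z \<in> cbox 0 (\<chi> i. 1)"
      using z by (auto simp: simplex_on_def mem_box_cart)
  qed
  then have "bounded (simplex_on :: (real ^ 'm) set)"
    by (meson bounded_cbox bounded_subset)
  moreover have "closed (simplex_on :: (real ^ 'm) set)"
    unfolding simplex_on_def
    by (intro closed_Collect_conj closed_Collect_all closed_Collect_le closed_Collect_eq
        continuous_intros)
  ultimately show ?thesis by (simp add: compact_eq_bounded_closed)
qed

lemma convex_simplex_on: "convex (simplex_on :: (real ^ 'm::finite) set)"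
  unfolding convex_def simplex_on_def
  by (auto simp: sum.distrib sum_distrib_left[symmetric])

lemma simplex_on_nonempty: "(simplex_on :: (real ^ 'm::finite) set) \<noteq> {}"
proof -
  have "(\<chi> i. 1 / real CARD('m)) \<in> (simplex_on :: (real ^ 'm) set)"
    by (simp add: simplex_on_def)
  then show ?thesis by blast
qed

text \<open>
  Brouwer's theorem for \<open>z \<mapsto> F(z)\<^bsup>1/k\<^esup>\<close>, rescaled to coordinate sum 1. The nonvanishing of \<open>F\<close>
  is what permits the rescaling.
\<close>

lemma power_eigenvector_on_simplex:
  fixes F :: "real ^ 'm::finite \<Rightarrow> real ^ 'm"
  assumes cont: "continuous_on simplex_on F"
    and nonneg: "\<And>z i. z \<in> simplex_on \<Longrightarrow> 0 \<le> F z $ i"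
    and nonzero: "\<And>z. z \<in> simplex_on \<Longrightarrow> \<exists>i. 0 < F z $ i"
    and k: "0 < k"
  obtains z c where "z \<in> simplex_on" "0 < c" "\<And>i. F z $ i = c * (z $ i) ^ k"
proof -
  define s where "s z = (\<Sum>i\<in>UNIV. root k (F z $ i))" for z
  define G where "G z = (\<chi> i. root k (F z $ i) / s z)" for z
  have s: "0 < s z" if z: "z \<in> simplex_on" for z
  proof -
    obtain i where "0 < F z $ i" using nonzero[OF z] by blast
    then show ?thesis unfolding s_def
      using k nonneg[OF z] by (intro sum_pos2[of _ i]) (auto intro: real_root_ge_zero)
  qed
  have "continuous_on simplex_on G"
    unfolding G_def s_def
    using s cont by (intro continuous_intros) (auto simp flip: s_def dest: s)
  moreover have "G \<in> simplex_on \<rightarrow> simplex_on"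
    using s k nonneg
    by (auto simp: G_def simplex_on_def sum_divide_distrib[symmetric] s_def[symmetric]
        intro!: divide_nonneg_pos real_root_ge_zero) (force simp: simplex_on_def)+
  ultimately obtain z where z: "z \<in> simplex_on" "G z = z"
    using brouwer[OF compact_simplex_on convex_simplex_on simplex_on_nonempty] by blast
  have "F z $ i = s z ^ k * (z $ i) ^ k" for i
  proof -
    have "root k (F z $ i) / s z = z $ i"
      using z(2) by (metis G_def vec_lambda_beta)
    then have "root k (F z $ i) = s z * z $ i"
      using s[OF z(1)] by (auto simp: field_simps)
    then show ?thesis
      using k nonneg[OF z(1)] by (metis power_mult_distrib real_root_pow_pos2)
  qed
  then show ?thesis using that z(1) s[OF z(1)] by (metis zero_less_power)
qed

section \<open>The quadratic inequality\<close>

text \<open>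
  Multiplying the first inequality by \<open>l\<close> and inserting the second eliminates \<open>W\<close> and leaves
  \<open>l * (l - u) \<le> v * m\<close>, of which \<open>root_expr u v m\<close> is the larger root.
\<close>

lemma le_root_expr:
  assumes "l * M \<le> u * M + v * W" "l * W \<le> m * M" "0 < M" "0 \<le> W" "0 \<le> u" "0 \<le> v" "0 \<le> m"
  shows "l \<le> root_expr u v m"
proof (cases "l \<le> u")
  case True
  have "u \<le> sqrt (u\<^sup>2 + 4 * v * m)"
    using assms by (intro real_le_rsqrt) auto
  then show ?thesis using True by (simp add: root_expr_def)
next
  case False
  then have l: "0 < l" using assms by linarith
  have "(l * (l - u)) * M = l * (l * M - u * M)" by (simp add: algebra_simps)
  also have "\<dots> \<le> l * (v * W)" using assms l by (intro mult_left_mono) auto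
  also have "\<dots> = v * (l * W)" by simp
  also have "\<dots> \<le> v * (m * M)" using assms by (intro mult_left_mono) auto
  finally have "(l * (l - u)) * M \<le> (v * m) * M" by (simp add: mult.assoc)
  then have "l * (l - u) \<le> v * m" using assms by simp
  then have "(2 * l - u)\<^sup>2 \<le> u\<^sup>2 + 4 * v * m"
    by (simp add: power2_eq_square algebra_simps)
  then have "2 * l - u \<le> sqrt (u\<^sup>2 + 4 * v * m)" by (rule real_le_rsqrt)
  then show ?thesis by (simp add: root_expr_def)
qed

lemma root_expr_le:
  assumes "u * M + v * W \<le> l * M" "m * M \<le> l * W" "0 < M" "0 \<le> W" "0 \<le> u" "0 \<le> v" "0 \<le> m"
  shows "root_expr u v m \<le> l"
proof -
  have "u * M \<le> l * M" using assms by (meson add_increasing2 le_add_same_cancel1 mult_nonneg_nonneg order_trans)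
  then have lu: "u \<le> l" using assms by simp
  then have l: "0 \<le> l" using assms by linarith
  have "v * m * M = v * (m * M)" by simp
  also have "\<dots> \<le> v * (l * W)" using assms by (intro mult_left_mono) auto
  also have "\<dots> = l * (v * W)" by simp
  also have "\<dots> \<le> l * (l * M - u * M)" using assms l by (intro mult_left_mono) auto
  also have "\<dots> = (l * (l - u)) * M" by (simp add: algebra_simps)
  finally have "v * m \<le> l * (l - u)" using assms by simp
  then have "u\<^sup>2 + 4 * v * m \<le> (2 * l - u)\<^sup>2"
    by (simp add: power2_eq_square algebra_simps)
  then have "sqrt (u\<^sup>2 + 4 * v * m) \<le> 2 * l - u"
    using lu l by (intro real_le_lsqrt) auto
  then show ?thesis by (simp add: root_expr_def)
qed

section \<open>Monotonicity, homogeneity and Euler's identity\<close>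

locale nonneg_rect_tensor =
  fixes p q :: nat and a :: "'n::finite rect_tensor"
  assumes p: "p \<ge> 1" and q: "q \<ge> 1" and nonneg: "nonneg_tensor p q a"
begin

abbreviation "d \<equiv> p + q - 1"
abbreviation "A \<equiv> tensor_map p q a"

lemma slots_mono: "slots p q T k \<subseteq> slots p q UNIV k"
  by (auto simp: slots_def Delta_def Omega_def split: sum.splits)

lemma finite_slots:
  fixes T :: "'n set"
  shows "finite (slots p q T k)"
proof -
  have "finite {is :: 'n list. length is = m}" for m
    using finite_lists_length_eq[of "UNIV :: 'n set" m] by simp
  then have "finite ({is :: 'n list. length is = p - 1} \<times> {is :: 'n list. length is = q})"
    "finite ({is :: 'n list. length is = p} \<times> {is :: 'n list. length is = q - 1})"
    by blast+
  then have "finite (Delta p q UNIV :: ('n list \<times> 'n list) set)"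
    "finite (Omega p q UNIV :: ('n list \<times> 'n list) set)"
    unfolding Delta_def Omega_def by (auto elim!: finite_subset[rotated])
  then have "finite (slots p q UNIV k)" by (cases k) (auto simp: slots_def)
  then show ?thesis using slots_mono finite_subset by blast
qed

lemma length_word: "t \<in> slots p q T k \<Longrightarrow> length (word t) = d"
  using p q by (auto simp: slots_def Delta_def Omega_def word_def split: sum.splits)

lemma set_word: "t \<in> slots p q T k \<Longrightarrow> set (word t) \<subseteq> T <+> T"
  by (auto simp: slots_def Delta_def Omega_def word_def split: sum.splits)

lemma entry_nonneg: "t \<in> slots p q T k \<Longrightarrow> 0 \<le> entry a k t"
  using nonneg p q
  by (cases k; cases t) (auto simp: slots_def Delta_def Omega_def nonneg_tensor_def)

lemma part_nonneg: "0 \<le> part p q a T k"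
  unfolding part_def by (intro sum_nonneg entry_nonneg)

lemma copart_nonneg: "0 \<le> copart p q a T k"
  unfolding copart_def by (intro sum_nonneg entry_nonneg[of _ UNIV]) auto

lemma row_part_eq:
  "row_part a (Delta p q T) j = part p q a T (Inl j)"
  "row_part a (Delta_compl p q T) j = copart p q a T (Inl j)"
  using entry_nonneg[of _ UNIV "Inl j"]
  unfolding row_part_def part_def copart_def Delta_compl_def
  by (auto simp: slots_def Delta_def intro!: sum.cong)

lemma col_part_eq:
  "col_part a (Omega p q T) j = part p q a T (Inr j)"
  "col_part a (Omega_compl p q T) j = copart p q a T (Inr j)"
  using entry_nonneg[of _ UNIV "Inr j"]
  unfolding col_part_def part_def copart_def Omega_compl_def
  by (auto simp: slots_def Omega_def intro!: sum.cong)

lemma row_sum_eq: "row_sum p q a i = part p q a UNIV (Inl i)"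
  and col_sum_eq: "col_sum p q a i = part p q a UNIV (Inr i)"
  by (simp_all add: row_sum_def col_sum_def row_part_eq col_part_eq)

lemma tensor_map_split:
  "A z k = (\<Sum>t\<in>slots p q UNIV k - slots p q T k. entry a k t * (\<Prod>m\<leftarrow>word t. z m))
         + (\<Sum>t\<in>slots p q T k. entry a k t * (\<Prod>m\<leftarrow>word t. z m))"
  unfolding tensor_map_def by (rule sum.subset_diff[OF slots_mono finite_slots])

lemma tensor_map_le_split:
  assumes "\<And>m. 0 \<le> z m" "\<And>m. z m \<le> M" "\<And>m. m \<in> T <+> T \<Longrightarrow> z m \<le> W"
  shows "A z k \<le> copart p q a T k * M ^ d + part p q a T k * W ^ d"
  unfolding tensor_map_split[of _ _ T] copart_def part_def sum_distrib_right
proof (intro add_mono sum_mono mult_left_mono)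
  fix t assume t: "t \<in> slots p q UNIV k - slots p q T k"
  show "(\<Prod>m\<leftarrow>word t. z m) \<le> M ^ d"
    using prod_list_mono_on[of "word t" z "\<lambda>_. M"] assms t length_word[of t UNIV k]
    by (auto simp: prod_list_const)
next
  fix t assume t: "t \<in> slots p q T k"
  show "(\<Prod>m\<leftarrow>word t. z m) \<le> W ^ d"
    using prod_list_mono_on[of "word t" z "\<lambda>_. W"] assms t length_word[of t T k] set_word[of t T k]
    by (auto simp: prod_list_const)
qed (auto intro: entry_nonneg entry_nonneg[of _ UNIV])

lemma tensor_map_ge_split:
  assumes "0 \<le> M" "0 \<le> W" "\<And>m. M \<le> z m" "\<And>m. m \<in> T <+> T \<Longrightarrow> W \<le> z m"
  shows "copart p q a T k * M ^ d + part p q a T k * W ^ d \<le> A z k"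
  unfolding tensor_map_split[of _ _ T] copart_def part_def sum_distrib_right
proof (intro add_mono sum_mono mult_left_mono)
  fix t assume t: "t \<in> slots p q UNIV k - slots p q T k"
  show "M ^ d \<le> (\<Prod>m\<leftarrow>word t. z m)"
    using prod_list_mono_on[of "word t" "\<lambda>_. M" z] assms t length_word[of t UNIV k]
    by (auto simp: prod_list_const)
next
  fix t assume t: "t \<in> slots p q T k"
  show "W ^ d \<le> (\<Prod>m\<leftarrow>word t. z m)"
    using prod_list_mono_on[of "word t" "\<lambda>_. W" z] assms t length_word[of t T k] set_word[of t T k]
    by (auto simp: prod_list_const)
qed (auto intro: entry_nonneg entry_nonneg[of _ UNIV])

lemma tensor_map_le_total:
  assumes "\<And>m. 0 \<le> z m" "\<And>m. z m \<le> M"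
  shows "A z k \<le> part p q a UNIV k * M ^ d"
  using tensor_map_le_split[of z M UNIV M k] assms by (simp add: copart_def)

lemma tensor_map_ge_total:
  assumes "0 \<le> M" "\<And>m. M \<le> z m"
  shows "part p q a UNIV k * M ^ d \<le> A z k"
  using tensor_map_ge_split[of M M z UNIV k] assms by (simp add: copart_def)

lemma tensor_map_mono:
  assumes "\<And>m. 0 \<le> z m \<and> z m \<le> z' m"
  shows "A z k \<le> A z' k"
  unfolding tensor_map_def
  by (intro sum_mono mult_left_mono entry_nonneg prod_list_mono_on[THEN conjunct2] assms)

lemma tensor_map_nonneg:
  assumes "\<And>m. 0 \<le> z m"
  shows "0 \<le> A z k"
  unfolding tensor_map_def using prod_list_mono_on[of _ z z] assms
  by (intro sum_nonneg mult_nonneg_nonneg entry_nonneg) auto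

lemma tensor_map_scale: "A (\<lambda>m. c * z m) k = c ^ d * A z k"
proof -
  have "(\<Prod>m\<leftarrow>ws. c * z m) = c ^ length ws * (\<Prod>m\<leftarrow>ws. z m)" for ws :: "('n + 'n) list"
    by (induction ws) auto
  then show ?thesis
    unfolding tensor_map_def sum_distrib_left
    by (intro sum.cong) (auto simp: length_word)
qed

lemma tendsto_tensor_map:
  assumes "\<And>m. ((\<lambda>x. f x m) \<longlongrightarrow> g m) F"
  shows "((\<lambda>x. A (f x) k) \<longlongrightarrow> A g k) F"
  unfolding tensor_map_def by (intro tendsto_intros tendsto_prod_list_map assms)

text \<open>
  Both sides are the form \<open>A x\<^bsup>p\<^esup> y\<^bsup>q\<^esup>\<close>: the distinguished index is put back in front of its list.
\<close>

lemma euler_identity: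
  "(\<Sum>i\<in>UNIV. z (Inl i) * A z (Inl i)) = (\<Sum>j\<in>UNIV. z (Inr j) * A z (Inr j))"
proof -
  let ?f = "\<lambda>(is, js). a is js * ((\<Prod>i\<leftarrow>is. z (Inl i)) * (\<Prod>j\<leftarrow>js. z (Inr j)))"
  let ?B = "{(is :: 'n list, js :: 'n list). length is = p \<and> length js = q}"
  have cons: "hd xs # tl xs = xs" if "length xs = n" "n \<ge> 1" for xs :: "'n list" and n
    using that by (intro list.collapse) auto
  have "(\<Sum>i\<in>UNIV. z (Inl i) * A z (Inl i)) =
    (\<Sum>(i, t)\<in>UNIV \<times> Delta p q UNIV. z (Inl i) * (entry a (Inl i) t * (\<Prod>m\<leftarrow>word t. z m)))"
    by (simp add: tensor_map_def slots_def sum_distrib_left sum.cartesian_product)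
  also have "\<dots> = sum ?f ?B"
    using p by (intro sum.reindex_bij_witness[of _ "\<lambda>(is, js). (hd is, (tl is, js))"
          "\<lambda>(i, (is, js)). (i # is, js)"])
      (auto simp: Delta_def word_def o_def cons mult_ac)
  finally have l: "(\<Sum>i\<in>UNIV. z (Inl i) * A z (Inl i)) = sum ?f ?B" .
  have "(\<Sum>i\<in>UNIV. z (Inr i) * A z (Inr i)) =
    (\<Sum>(i, t)\<in>UNIV \<times> Omega p q UNIV. z (Inr i) * (entry a (Inr i) t * (\<Prod>m\<leftarrow>word t. z m)))"
    by (simp add: tensor_map_def slots_def sum_distrib_left sum.cartesian_product)
  also have "\<dots> = sum ?f ?B"
    using q by (intro sum.reindex_bij_witness[of _ "\<lambda>(is, js). (hd js, (is, tl js))"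
          "\<lambda>(j, (is, js)). (is, j # js)"])
      (auto simp: Omega_def word_def o_def cons mult_ac)
  finally show ?thesis using l by simp
qed

section \<open>Comparison of subsolutions and supersolutions\<close>

lemma Theta_le_root_expr:
  assumes "T \<in> {S, - S}" "f \<in> T" "g \<in> - T" "k = Inl g \<or> k = Inr g"
  shows "Theta p q a S \<le> root_expr (copart p q a T k) (part p q a T k)
    (min (part p q a UNIV (Inl f)) (part p q a UNIV (Inr f)))" (is "_ \<le> ?r")
proof -
  have "Theta_hat p q a T \<le> ?r \<or> Theta_tilde p q a T \<le> ?r"
    using assms(4)
  proof
    assume "k = Inl g"
    then have "Theta_hat p q a T \<le> ?r"
      unfolding Theta_hat_def using assms
      by (intro Min_le) (auto simp: row_part_eq row_sum_eq col_sum_eq intro!: image_eqI[of _ _ "(f, g)"])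
    then show ?thesis ..
  next
    assume "k = Inr g"
    then have "Theta_tilde p q a T \<le> ?r"
      unfolding Theta_tilde_def using assms
      by (intro Min_le) (auto simp: col_part_eq row_sum_eq col_sum_eq intro!: image_eqI[of _ _ "(f, g)"])
    then show ?thesis ..
  qed
  then show ?thesis using assms(1) by (auto simp: Theta_def)
qed

lemma root_expr_le_Phi:
  assumes "T \<in> {S, - S}" "f \<in> T" "g \<in> - T" "k = Inl g \<or> k = Inr g"
  shows "root_expr (copart p q a T k) (part p q a T k)
    (max (part p q a UNIV (Inl f)) (part p q a UNIV (Inr f))) \<le> Phi p q a S" (is "?r \<le> _")
proof -
  have "?r \<le> Phi_hat p q a T \<or> ?r \<le> Phi_tilde p q a T"
    using assms(4)
  proof
    assume "k = Inl g"
    then have "?r \<le> Phi_hat p q a T"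
      unfolding Phi_hat_def using assms
      by (intro Max_ge) (auto simp: row_part_eq row_sum_eq col_sum_eq intro!: image_eqI[of _ _ "(f, g)"])
    then show ?thesis ..
  next
    assume "k = Inr g"
    then have "?r \<le> Phi_tilde p q a T"
      unfolding Phi_tilde_def using assms
      by (intro Max_ge) (auto simp: col_part_eq row_sum_eq col_sum_eq intro!: image_eqI[of _ _ "(f, g)"])
    then show ?thesis ..
  qed
  then show ?thesis using assms(1) by (auto simp: Phi_def)
qed

text \<open>
  The block \<open>T\<close> is chosen so that the index \<open>g\<close> of an extremal coordinate \<open>k\<close> lies outside it, as the index \<open>j\<close> does
  in the definitions of the bounds.
\<close>

lemma obtain_block:
  fixes k :: "'n + 'n"
  assumes "S \<noteq> {}" "S \<noteq> UNIV"
  obtains T g where "T \<in> {S, - S}" "T \<noteq> {}" "g \<in> - T" "k = Inl g \<or> k = Inr g"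
proof -
  obtain g where "k = Inl g \<or> k = Inr g" by (cases k) auto
  then show ?thesis using assms that[of S g] that[of "- S" g] by (cases "g \<in> S") auto
qed

text \<open>
  Equation \<open>k\<close> of the smallest coordinate and equation \<open>h\<close> of the smallest coordinate over the
  complementary block, combined by \<open>root_expr_le\<close>. As \<open>h\<close> may belong to \<open>x\<close> or to \<open>y\<close>, only the
  minimum of the row and the column sum is available.
\<close>

lemma Theta_le_supersolution:
  assumes S: "S \<noteq> {}" "S \<noteq> UNIV"
    and pos: "\<And>m. 0 < z m" and super: "\<And>m. A z m \<le> c * z m ^ d"
  shows "Theta p q a S \<le> c"
proof -
  obtain k where k: "\<And>m. z k \<le> z m"
    using ex_is_arg_min_if_finite[of UNIV z] by (auto simp: is_arg_min_linorder)
  obtain T g where T: "T \<in> {S, - S}" "T \<noteq> {}" "g \<in> - T" "k = Inl g \<or> k = Inr g"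
    using obtain_block[OF S] .
  obtain h where h: "h \<in> T <+> T" "\<And>m. m \<in> T <+> T \<Longrightarrow> z h \<le> z m"
    using ex_is_arg_min_if_finite[of "T <+> T" z] T(2) by (auto simp: is_arg_min_linorder)
  obtain f where f: "f \<in> T" "h = Inl f \<or> h = Inr f" using h(1) by auto
  let ?m = "min (part p q a UNIV (Inl f)) (part p q a UNIV (Inr f))"
  have "?m * z k ^ d \<le> part p q a UNIV h * z k ^ d"
    using f pos[of k] by (intro mult_right_mono) auto
  also have "\<dots> \<le> A z h" using k pos[of k] by (intro tensor_map_ge_total) auto
  also have "\<dots> \<le> c * z h ^ d" by (rule super)
  finally have 1: "?m * z k ^ d \<le> c * z h ^ d" .
  have "copart p q a T k * z k ^ d + part p q a T k * z h ^ d \<le> A z k"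
    using k h pos by (intro tensor_map_ge_split) (auto intro: less_imp_le)
  also have "\<dots> \<le> c * z k ^ d" by (rule super)
  finally have "root_expr (copart p q a T k) (part p q a T k) ?m \<le> c"
    using 1 pos[of k] pos[of h]
    by (intro root_expr_le[of _ "z k ^ d" _ "z h ^ d"]) (auto simp: part_nonneg copart_nonneg)
  then show ?thesis using Theta_le_root_expr[OF T(1) f(1) T(3,4)] by linarith
qed

text \<open>
  The mirror image of the lower bound, with largest coordinates. Here the coordinate \<open>z h\<close> may be zero,
  because only \<open>z k\<close> is divided out.
\<close>

lemma subsolution_le_Phi:
  assumes S: "S \<noteq> {}" "S \<noteq> UNIV"
    and nn: "\<And>m. 0 \<le> z m" and nz: "\<exists>m. 0 < z m" and sub: "\<And>m. c * z m ^ d \<le> A z m"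
  shows "c \<le> Phi p q a S"
proof -
  obtain k where k: "\<And>m. z m \<le> z k"
    using finite_maximiser[of UNIV z] by auto
  have zk: "0 < z k" using nz k by (meson less_le_trans)
  obtain T g where T: "T \<in> {S, - S}" "T \<noteq> {}" "g \<in> - T" "k = Inl g \<or> k = Inr g"
    using obtain_block[OF S] .
  obtain h where h: "h \<in> T <+> T" "\<And>m. m \<in> T <+> T \<Longrightarrow> z m \<le> z h"
    using finite_maximiser[of "T <+> T" z] T(2) by auto
  obtain f where f: "f \<in> T" "h = Inl f \<or> h = Inr f" using h(1) by auto
  let ?m = "max (part p q a UNIV (Inl f)) (part p q a UNIV (Inr f))"
  have "c * z h ^ d \<le> A z h" by (rule sub)
  also have "\<dots> \<le> part p q a UNIV h * z k ^ d" using k nn by (intro tensor_map_le_total) auto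
  also have "\<dots> \<le> ?m * z k ^ d"
    using f zk by (intro mult_right_mono) auto
  finally have 1: "c * z h ^ d \<le> ?m * z k ^ d" .
  have "c * z k ^ d \<le> A z k" by (rule sub)
  also have "\<dots> \<le> copart p q a T k * z k ^ d + part p q a T k * z h ^ d"
    using k h nn by (intro tensor_map_le_split) auto
  finally have "c \<le> root_expr (copart p q a T k) (part p q a T k) ?m"
    using 1 zk nn[of h]
    by (intro le_root_expr[of _ "z k ^ d" _ _ "z h ^ d"])
      (auto simp: part_nonneg copart_nonneg le_max_iff_disj)
  then show ?thesis using root_expr_le_Phi[OF T(1) f(1) T(3,4)] by linarith
qed

text \<open>
  The argument of Collatz and Wielandt: scale \<open>z\<close> until it touches \<open>y\<close> from above and compare the
  equations at a point of contact.
\<close>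

lemma subsolution_le_supersolution:
  assumes pos: "\<And>m. 0 < z m" and super: "\<And>m. A z m \<le> c * z m ^ d"
    and nn: "\<And>m. 0 \<le> y m" and nz: "\<exists>m. 0 < y m" and sub: "\<And>m. l * y m ^ d \<le> A y m"
  shows "l \<le> c"
proof -
  obtain k where k: "\<And>m. y m / z m \<le> y k / z k"
    using finite_maximiser[of UNIV "\<lambda>m. y m / z m"] by auto
  define t where "t = y k / z k"
  have le: "y m \<le> t * z m" for m
    using k[of m] pos[of m] by (simp add: t_def pos_divide_le_eq)
  have yk: "y k = t * z k" using pos[of k] by (simp add: t_def)
  obtain m where "0 < y m" using nz by blast
  then have "0 < t * z m" using le[of m] by linarith
  then have t: "0 < t" using pos[of m] by (simp add: zero_less_mult_iff)
  have "l * y k ^ d \<le> A y k" by (rule sub)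
  also have "\<dots> \<le> A (\<lambda>m. t * z m) k" using nn le by (intro tensor_map_mono) auto
  also have "\<dots> = t ^ d * A z k" by (rule tensor_map_scale)
  also have "\<dots> \<le> t ^ d * (c * z k ^ d)" using t by (intro mult_left_mono super) auto
  also have "\<dots> = c * y k ^ d" by (simp add: yk power_mult_distrib)
  finally show ?thesis using t pos[of k] by (simp add: yk)
qed

section \<open>A nonnegative singular pair\<close>

text \<open>
  Summing the equations against \<open>x\<close> and against \<open>y\<close> gives \<open>c\<close> times the two power sums. The results
  agree by Euler's identity and the symmetry of the perturbation, hence so do the power sums.
\<close>

lemma perturbed_eigenvector:
  assumes e: "0 < e"
  obtains z :: "real ^ ('n + 'n)" and c where
    "z \<in> simplex_on" "\<And>m. 0 < z $ m"
    "\<And>m. c * (z $ m) ^ d = A (($) z) m + e * opposite_mass (($) z) m"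
    "(\<Sum>i\<in>UNIV. (z $ Inl i) ^ (p + q)) = (\<Sum>j\<in>UNIV. (z $ Inr j) ^ (p + q))"
proof -
  define F :: "real ^ ('n + 'n) \<Rightarrow> real ^ ('n + 'n)"
    where "F z = (\<chi> m. A (($) z) m + e * opposite_mass (($) z) m)" for z
  have nn: "0 \<le> z $ m" if "z \<in> simplex_on" for z :: "real ^ ('n + 'n)" and m
    using that by (simp add: simplex_on_def)
  have one: "(\<Sum>i\<in>UNIV. z $ Inl i) + (\<Sum>j\<in>UNIV. z $ Inr j) = 1"
    if "z \<in> simplex_on" for z :: "real ^ ('n + 'n)"
    using that by (simp add: simplex_on_def sum_sum_type)
  have opp: "0 \<le> opposite_mass (($) z) m" if "z \<in> simplex_on" for z :: "real ^ ('n + 'n)" and m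
    using nn[OF that] by (auto simp: opposite_mass_def intro!: sum_nonneg split: sum.splits)
  have d: "0 < d" using p q by simp
  have "continuous_on simplex_on F"
    unfolding continuous_on_def
  proof
    fix z :: "real ^ ('n + 'n)"
    have "((\<lambda>w. w $ m) \<longlongrightarrow> z $ m) (at z within simplex_on)" for m
      by (intro tendsto_intros)
    then have "((\<lambda>w. F w $ m) \<longlongrightarrow> F z $ m) (at z within simplex_on)" for m
      unfolding F_def vec_lambda_beta opposite_mass_def
      by (cases m) (auto intro!: tendsto_intros tendsto_tensor_map)
    then show "(F \<longlongrightarrow> F z) (at z within simplex_on)"
      by (rule vec_tendstoI)
  qed
  moreover have "0 \<le> F z $ m" if "z \<in> simplex_on" for z m
    unfolding F_def using e opp[OF that] nn[OF that] by (simp add: tensor_map_nonneg)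
  moreover have "\<exists>m. 0 < F z $ m" if z: "z \<in> simplex_on" for z
  proof -
    have "0 < (\<Sum>i\<in>UNIV. z $ Inl i) \<or> 0 < (\<Sum>j\<in>UNIV. z $ Inr j)"
      using one[OF z] by linarith
    then have "\<exists>m. 0 < opposite_mass (($) z) m"
      by (auto simp: opposite_mass_def split: sum.splits)
    then obtain m where "0 < opposite_mass (($) z) m" ..
    then have "0 < F z $ m"
      unfolding F_def using e nn[OF z] by (simp add: tensor_map_nonneg add_nonneg_pos)
    then show ?thesis ..
  qed
  ultimately obtain z c where z: "z \<in> simplex_on" and c: "0 < c"
    and eq: "\<And>m. F z $ m = c * (z $ m) ^ d"
    using power_eigenvector_on_simplex[of F d] d by metis
  let ?X = "\<Sum>i\<in>UNIV. z $ Inl i" and ?Y = "\<Sum>j\<in>UNIV. z $ Inr j"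
  have eq': "c * (z $ m) ^ d = A (($) z) m + e * opposite_mass (($) z) m" for m
    using eq[of m] by (simp add: F_def)
  have posI: "0 < z $ m" if "0 < opposite_mass (($) z) m" for m
  proof -
    have "0 < c * (z $ m) ^ d"
      unfolding eq' using that e nn[OF z] by (intro add_nonneg_pos tensor_map_nonneg) auto
    then show ?thesis using c d nn[OF z, of m]
      by (metis less_le mult_zero_right zero_power)
  qed
  \<comment> \<open>If one half had no mass, the other would have mass 1 and its perturbing term would make the
    first half positive.\<close>
  have "0 < ?X"
  proof (rule ccontr)
    assume X: "\<not> 0 < ?X"
    then have "0 < ?Y" using one[OF z] by linarith
    then have "0 < z $ Inl i" for i by (intro posI) (simp add: opposite_mass_def)
    then show False using X by (simp add: sum_pos)
  qed
  then have Y: "0 < z $ Inr j" for j by (intro posI) (simp add: opposite_mass_def)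
  then have "0 < ?Y" by (intro sum_pos) auto
  then have X: "0 < z $ Inl i" for i by (intro posI) (simp add: opposite_mass_def)
  have pos: "0 < z $ m" for m using X Y by (cases m) auto
  have pq: "x ^ (p + q) = x * x ^ d" for x :: real
    using p by (cases p) auto
  have terms_X: "z $ Inl i * (c * (z $ Inl i) ^ d) = z $ Inl i * A (($) z) (Inl i) + e * ?Y * z $ Inl i" for i
    unfolding eq' by (simp add: opposite_mass_def algebra_simps)
  have terms_Y: "z $ Inr j * (c * (z $ Inr j) ^ d) = z $ Inr j * A (($) z) (Inr j) + e * ?X * z $ Inr j" for j
    unfolding eq' by (simp add: opposite_mass_def algebra_simps)
  have "c * (\<Sum>i\<in>UNIV. (z $ Inl i) ^ (p + q))
      = (\<Sum>i\<in>UNIV. z $ Inl i * (c * (z $ Inl i) ^ d))"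
    by (simp add: pq sum_distrib_left mult_ac)
  also have "\<dots> = (\<Sum>i\<in>UNIV. z $ Inl i * A (($) z) (Inl i)) + e * ?Y * ?X"
    by (simp only: terms_X sum.distrib sum_distrib_left)
  also have "\<dots> = (\<Sum>j\<in>UNIV. z $ Inr j * A (($) z) (Inr j)) + e * ?X * ?Y"
    using euler_identity[of "($) z"] by simp
  also have "\<dots> = (\<Sum>j\<in>UNIV. z $ Inr j * (c * (z $ Inr j) ^ d))"
    by (simp only: terms_Y sum.distrib sum_distrib_left)
  also have "\<dots> = c * (\<Sum>j\<in>UNIV. (z $ Inr j) ^ (p + q))"
    by (simp add: pq sum_distrib_left mult_ac)
  finally have "(\<Sum>i\<in>UNIV. (z $ Inl i) ^ (p + q)) = (\<Sum>j\<in>UNIV. (z $ Inr j) ^ (p + q))"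
    using c by simp
  then show ?thesis using that z pos eq' by blast
qed

text \<open>
  The limit of perturbed eigenvectors. The last property says that \<open>l\<close> is at least the infimum of the
  values \<open>c\<close> attained by positive supersolutions, so every common lower bound of these is a
  lower bound of \<open>l\<close>.
\<close>

lemma perron_singular_pair:
  obtains z l where
    "\<And>m. 0 \<le> z m" "\<exists>i. 0 < z (Inl i)" "\<exists>j. 0 < z (Inr j)"
    "\<And>m. A z m = l * z m ^ d"
    "\<And>b. (\<And>w c. (\<And>m. 0 < w m) \<Longrightarrow> (\<And>m. A w m \<le> c * w m ^ d) \<Longrightarrow> b \<le> c) \<Longrightarrow> b \<le> l"
proof -
  define e where "e n = inverse (real (Suc n))" for n
  have e: "0 < e n" for n by (simp add: e_def)
  have e0: "e \<longlonglongrightarrow> 0" unfolding e_def by (rule LIMSEQ_inverse_real_of_nat)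
  have "\<forall>n. \<exists>z c. z \<in> simplex_on \<and> (\<forall>m. 0 < z $ m) \<and>
    (\<forall>m. c * (z $ m) ^ d = A (($) z) m + e n * opposite_mass (($) z) m) \<and>
    (\<Sum>i\<in>UNIV. (z $ Inl i) ^ (p + q)) = (\<Sum>j\<in>UNIV. (z $ Inr j) ^ (p + q))"
    using perturbed_eigenvector[OF e] by metis
  then obtain Z C where Z: "\<And>n. Z n \<in> simplex_on" and pos: "\<And>n m. 0 < Z n $ m"
    and eig: "\<And>n m. C n * (Z n $ m) ^ d = A (($) (Z n)) m + e n * opposite_mass (($) (Z n)) m"
    and bal: "\<And>n. (\<Sum>i\<in>UNIV. (Z n $ Inl i) ^ (p + q)) = (\<Sum>j\<in>UNIV. (Z n $ Inr j) ^ (p + q))"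
    by metis
  obtain v r where v: "v \<in> simplex_on" and r: "strict_mono r" and lim: "(Z \<circ> r) \<longlonglongrightarrow> v"
    using compact_simplex_on Z unfolding compact_def by metis
  define z where "z = ($) v"
  have Zz: "(\<lambda>n. Z (r n) $ m) \<longlonglongrightarrow> z m" for m
    using tendsto_vec_nth[OF lim, of m] by (simp add: z_def o_def)
  have er: "(\<lambda>n. e (r n)) \<longlonglongrightarrow> 0" using LIMSEQ_subseq_LIMSEQ[OF e0 r] by (simp add: o_def)
  have nn: "0 \<le> z m" for m using v by (simp add: z_def simplex_on_def)
  have nz: "\<exists>m. 0 < z m"
  proof (rule ccontr)
    assume "\<nexists>m. 0 < z m"
    then have "z m = 0" for m using nn[of m] by (simp add: not_less order_antisym)
    then show False using v by (simp add: z_def simplex_on_def)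
  qed
  then obtain k where k: "0 < z k" ..
  have opp: "(\<lambda>n. opposite_mass (($) (Z (r n))) m) \<longlonglongrightarrow> opposite_mass z m" for m
    unfolding opposite_mass_def by (cases m) (auto intro!: tendsto_intros Zz)
  have rhs: "(\<lambda>n. C (r n) * (Z (r n) $ m) ^ d) \<longlonglongrightarrow> A z m" for m
  proof -
    have "(\<lambda>n. A (($) (Z (r n))) m + e (r n) * opposite_mass (($) (Z (r n))) m)
        \<longlonglongrightarrow> A z m + 0 * opposite_mass z m"
      by (intro tendsto_intros tendsto_tensor_map Zz er opp)
    then show ?thesis by (simp only: eig mult_zero_left add_0_right)
  qed
  \<comment> \<open>The eigenvalues converge because they are quotients at a coordinate that stays positive.\<close>
  define l where "l = A z k / z k ^ d"
  have "(\<lambda>n. C (r n) * (Z (r n) $ k) ^ d / (Z (r n) $ k) ^ d) \<longlonglongrightarrow> l"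
    unfolding l_def using k by (intro tendsto_intros rhs Zz) auto
  moreover have "Z n $ m \<noteq> 0" for n m using pos[of n m] by simp
  ultimately have Cl: "(\<lambda>n. C (r n)) \<longlonglongrightarrow> l" by simp
  have "A z m = l * z m ^ d" for m
    by (rule LIMSEQ_unique[OF rhs]) (intro tendsto_intros Cl Zz)
  moreover have "b \<le> l"
    if b: "\<And>w c. (\<And>m. 0 < w m) \<Longrightarrow> (\<And>m. A w m \<le> c * w m ^ d) \<Longrightarrow> b \<le> c" for b
  proof -
    have "0 \<le> opposite_mass (($) (Z n)) m" for n m
      by (auto simp: opposite_mass_def intro!: sum_nonneg less_imp_le[OF pos] split: sum.splits)
    then have "A (($) (Z n)) m \<le> C n * (Z n $ m) ^ d" for n m
      unfolding eig using e[of n] by (simp add: less_imp_le)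
    then have "b \<le> C n" for n using pos b by blast
    then show ?thesis using Cl by (intro LIMSEQ_le_const) auto
  qed
  moreover have "(\<exists>i. 0 < z (Inl i)) \<and> (\<exists>j. 0 < z (Inr j))"
  proof -
    \<comment> \<open>The equality of the power sums survives the limit, and a vanishing half would make both zero.\<close>
    have bal_z: "(\<Sum>i\<in>UNIV. z (Inl i) ^ (p + q)) = (\<Sum>j\<in>UNIV. z (Inr j) ^ (p + q))"
    proof (rule LIMSEQ_unique)
      show "(\<lambda>n. \<Sum>i\<in>UNIV. (Z (r n) $ Inl i) ^ (p + q)) \<longlonglongrightarrow> (\<Sum>i\<in>UNIV. z (Inl i) ^ (p + q))"
        by (intro tendsto_intros Zz)
      show "(\<lambda>n. \<Sum>i\<in>UNIV. (Z (r n) $ Inl i) ^ (p + q)) \<longlonglongrightarrow> (\<Sum>j\<in>UNIV. z (Inr j) ^ (p + q))"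
        unfolding bal by (intro tendsto_intros Zz)
    qed
    have half: "(\<exists>i. 0 < z (h i)) \<longleftrightarrow> (\<Sum>i\<in>UNIV. z (h i) ^ (p + q)) \<noteq> 0"
      for h :: "'n \<Rightarrow> 'n + 'n"
      using p nn by (subst sum_nonneg_eq_0_iff) (auto simp: less_le)
    show ?thesis using k half[of Inl] half[of Inr] bal_z by (cases k; metis)
  qed
  ultimately show ?thesis using that nn by blast
qed

section \<open>The largest singular value\<close>

lemma norm_monom_val: "cmod (monom_val x is) = (\<Prod>i\<leftarrow>is. cmod (x $ i))"
  unfolding monom_val_def by (induction "is") (auto simp: norm_mult)

lemma monom_val_of_real: "monom_val (\<chi> i. of_real (f i)) is = of_real (\<Prod>i\<leftarrow>is. f i)"
  unfolding monom_val_def by (induction "is") auto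

text \<open>
  The triangle inequality, applied to the moduli of the coordinates of a complex singular pair.
\<close>

lemma singular_value_subsolution:
  assumes "singular_value p q a \<mu>"
  obtains z where "\<And>m. 0 \<le> z m" "\<exists>m. 0 < z m" "\<And>m. cmod \<mu> * z m ^ d \<le> A z m"
proof -
  obtain x y where x: "x \<noteq> 0"
    and l: "tensor_left p q a x y = \<mu> *s vec_power x d"
    and r: "tensor_right p q a x y = \<mu> *s vec_power y d"
    using assms unfolding singular_value_def by blast
  define z where "z = case_sum (\<lambda>i. cmod (x $ i)) (\<lambda>j. cmod (y $ j))"
  have zw: "(\<Prod>m\<leftarrow>word (is, js). z m) = cmod (monom_val x is) * cmod (monom_val y js)" for "is" js
    by (simp add: word_def z_def norm_monom_val o_def)
  have "cmod \<mu> * z (Inl i) ^ d \<le> A z (Inl i)" for i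
  proof -
    have "cmod \<mu> * z (Inl i) ^ d = cmod (tensor_left p q a x y $ i)"
      by (simp add: l vec_power_def z_def norm_mult norm_power)
    also have "\<dots> \<le> (\<Sum>(is, js)\<in>Delta p q UNIV.
        cmod (of_real (a (i # is) js) * monom_val x is * monom_val y js))"
      unfolding tensor_left_def vec_lambda_beta by (rule order_trans[OF norm_sum]) (simp add: case_prod_unfold)
    also have "\<dots> = A z (Inl i)"
      unfolding tensor_map_def using entry_nonneg[of _ UNIV "Inl i"]
      by (intro sum.cong) (auto simp: slots_def zw norm_mult)
    finally show ?thesis .
  qed
  moreover have "cmod \<mu> * z (Inr j) ^ d \<le> A z (Inr j)" for j
  proof -
    have "cmod \<mu> * z (Inr j) ^ d = cmod (tensor_right p q a x y $ j)"
      by (simp add: r vec_power_def z_def norm_mult norm_power)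
    also have "\<dots> \<le> (\<Sum>(is, js)\<in>Omega p q UNIV.
        cmod (of_real (a is (j # js)) * monom_val x is * monom_val y js))"
      unfolding tensor_right_def vec_lambda_beta by (rule order_trans[OF norm_sum]) (simp add: case_prod_unfold)
    also have "\<dots> = A z (Inr j)"
      unfolding tensor_map_def using entry_nonneg[of _ UNIV "Inr j"]
      by (intro sum.cong) (auto simp: slots_def zw norm_mult)
    finally show ?thesis .
  qed
  ultimately have "cmod \<mu> * z m ^ d \<le> A z m" for m by (cases m) auto
  moreover obtain i where "x $ i \<noteq> 0" using x by (auto simp: vec_eq_iff)
  then have "0 < z (Inl i)" by (simp add: z_def)
  moreover have "0 \<le> z m" for m by (cases m) (auto simp: z_def)
  ultimately show ?thesis using that by blast
qed

lemma singular_value_of_real: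
  assumes "\<exists>i. 0 < z (Inl i)" "\<exists>j. 0 < z (Inr j)" and eig: "\<And>m. A z m = l * z m ^ d"
  shows "singular_value p q a (of_real l)"
proof -
  define x y :: "complex ^ 'n"
    where "x = (\<chi> i. of_real (z (Inl i)))" and "y = (\<chi> j. of_real (z (Inr j)))"
  have mon: "complex_of_real b * monom_val x is * monom_val y js
      = of_real (b * (\<Prod>m\<leftarrow>word (is, js). z m))" for b "is" js
    by (simp add: word_def x_def y_def monom_val_of_real o_def)
  have "tensor_left p q a x y $ i = of_real (A z (Inl i))" for i
    by (simp add: tensor_left_def tensor_map_def slots_def mon case_prod_unfold flip: of_real_sum)
      (auto intro!: sum.cong)
  moreover have "tensor_right p q a x y $ j = of_real (A z (Inr j))" for j
    by (simp add: tensor_right_def tensor_map_def slots_def mon case_prod_unfold flip: of_real_sum)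
      (auto intro!: sum.cong)
  moreover have "x \<noteq> 0" "y \<noteq> 0"
    using assms(1,2) by (auto simp: x_def y_def vec_eq_iff less_le)
  ultimately show ?thesis
    unfolding singular_value_def
    by (intro exI[of _ x] exI[of _ y]) (auto simp: vec_eq_iff vec_power_def eig, auto simp: x_def y_def)
qed

text \<open>
  The limit \<open>l\<close> of the perturbed eigenvalues is the largest singular value: it is one itself, and the
  modulus of any other lies below every positive supersolution.
\<close>

lemma largest_singular_value_bounds:
  assumes S: "S \<noteq> {}" "S \<noteq> UNIV"
  shows "Theta p q a S \<le> largest_singular_value p q a
    \<and> largest_singular_value p q a \<le> Phi p q a S"
proof -
  obtain z l where nn: "\<And>m. 0 \<le> z m" and x: "\<exists>i. 0 < z (Inl i)" and y: "\<exists>j. 0 < z (Inr j)"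
    and eig: "\<And>m. A z m = l * z m ^ d"
    and greatest: "\<And>b. (\<And>w c. (\<And>m. 0 < w m) \<Longrightarrow> (\<And>m. A w m \<le> c * w m ^ d) \<Longrightarrow> b \<le> c)
      \<Longrightarrow> b \<le> l"
    using perron_singular_pair by blast
  obtain k where k: "0 < z k" using x by blast
  have "0 \<le> l * z k ^ d" using tensor_map_nonneg[of z k] nn by (simp add: eig)
  then have "0 \<le> l" using zero_less_power[OF k, of d] by (simp add: zero_le_mult_iff not_le)
  have "largest_singular_value p q a = l"
    unfolding largest_singular_value_def
  proof (rule Greatest_equality)
    show "\<exists>\<mu>. singular_value p q a \<mu> \<and> l = cmod \<mu>"
      using singular_value_of_real[of z, OF x y eig] \<open>0 \<le> l\<close> by (intro exI[of _ "of_real l"]) simp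
    fix s assume "\<exists>\<mu>. singular_value p q a \<mu> \<and> s = cmod \<mu>"
    then obtain \<mu> where \<mu>: "singular_value p q a \<mu>" "s = cmod \<mu>" by blast
    then obtain w where w: "\<And>m. 0 \<le> w m" "\<exists>m. 0 < w m" "\<And>m. s * w m ^ d \<le> A w m"
      using singular_value_subsolution by metis
    show "s \<le> l" by (rule greatest) (rule subsolution_le_supersolution[OF _ _ w])
  qed
  moreover have "Theta p q a S \<le> l"
    by (rule greatest) (rule Theta_le_supersolution[OF S])
  moreover have "l \<le> Phi p q a S"
    by (rule subsolution_le_Phi[OF S, of z]) (use nn k eig in auto)
  ultimately show ?thesis by simp
qed

end

theorem theorem5:
  fixes p q :: nat and a :: "'n::finite rect_tensor" and S :: "'n set"
  assumes "p \<ge> 1" and "q \<ge> 1" and "CARD('n) \<ge> 2"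
    and "nonneg_tensor p q a"
    and "S \<noteq> {}" and "S \<noteq> UNIV"
  shows "Theta p q a S \<le> largest_singular_value p q a
    \<and> largest_singular_value p q a \<le> Phi p q a S"
proof -
  interpret nonneg_rect_tensor p q a by unfold_locales (use assms in auto)
  show ?thesis using assms by (intro largest_singular_value_bounds)
qed

end
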